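(* Let $\mathbb{F}$ be a field and let $W(t)=\sum_{n=0}^{\infty}\frac{t^n}{w_n}\in\mathbb{F}[[t]]$ with $w_0=1$ and $w_n\neq0$ for all $n$. A graded sequence $\{p_n(x)\}_{n\in\mathbb{N}}$ of polynomials in $\mathbb{F}[x]$ is $W$-Sheffer if and only if its $W$-dual basis $\{\varphi_r\}_{r\in\mathbb{N}}$ takes the form $\varphi_r=\xi\cdot_W\eta_W^r$ for all $r\in\mathbb{N}$, for some elements $\xi,\eta\in\mathbb{F}[x]^*$ with $v(\xi)=0$ and $v(\eta)=1$.
   Context: $\mathbb{N}=\{0,1,2,\dots\}$. A sequence of polynomials $\{p_n\}_{n\in\mathbb{N}}$ is graded if $\deg p_n=n$ for all $n$. $\mathbb{F}[x]^*$ is the space of linear functionals on $\mathbb{F}[x]$, which is a commutative ring under the product $\cdot_W$ defined by $(\varphi\cdot_W\psi)\big(\frac{x^n}{w_n}\big)=\sum_{k=0}^n\varphi\big(\frac{x^k}{w_k}\big)\psi\big(\frac{x^{n-k}}{w_{n-k}}\big)$, with identity $\varepsilon_0:p\mapsto p(0)$; $\eta_W^r$ denotes the $r$th power of $\eta$ with respect to $\cdot_W$. For $\varphi\in\mathbb{F}[x]^*$ put $v(\varphi)=\min\{n\in\mathbb{N}\mid\varphi(x^n)\neq0\}$, and $v(0)=\infty$. The $W$-dual basis of $\{p_n\}$ is the sequence $\{\varphi_r\}_{r\in\mathbb{N}}$ in $\mathbb{F}[x]^*$ determined by $\varphi_r\big(\frac{p_n}{w_n}\big)=\delta_{n,r}$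 for all $n,r$. For $h\in\mathbb{F}$ the $W$-translation $T_{h,W}$ is the linear operator on $\mathbb{F}[x]$ taking $\frac{x^n}{w_n}$ to $\sum_{k=0}^n\frac{h^{n-k}}{w_{n-k}}\cdot\frac{x^k}{w_k}$. For a graded sequence $\{p_n\}$, $Q_W$ is the linear operator on $\mathbb{F}[x]$ sending $\frac{p_n}{w_n}$ to $\frac{p_{n-1}}{w_{n-1}}$ for $n\geq1$ and $p_0$ to $0$. The graded sequence is called $W$-Sheffer if $Q_W$ commutes with $T_{h,W}$ for all $h\in\mathbb{F}$. *)

theory Defs
  imports "HOL-Computational_Algebra.Computational_Algebra" "HOL-Library.Extended_Nat"
begin

text \<open>
  The series \<open>W = (\<Sum>n. t^n / w\<^sub>n)\<close> is an element of the library type of formal power series.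
  Its coefficient \<open>fps_nth W n\<close> is \<open>1 / w\<^sub>n\<close>, hence \<open>x^n / w\<^sub>n\<close> is \<open>monom (fps_nth W n) n\<close> and
  \<open>p\<^sub>n / w\<^sub>n\<close> is \<open>smult (fps_nth W n) (p n)\<close>.
  The maps below that are determined by linearity and their values on a basis are introduced by
  definite description; \<open>linear_ex1\<close> shows that they exist and are unique when no coefficient
  of \<open>W\<close> vanishes.
\<close>

definition graded :: "(nat \<Rightarrow> 'a::field poly) \<Rightarrow> bool" where
  "graded p \<longleftrightarrow> (\<forall>n. p n \<noteq> 0 \<and> degree (p n) = n)"

definition functionals :: "('a::field poly \<Rightarrow> 'a) set" where
  "functionals = {\<phi>. Vector_Spaces.linear smult (*) \<phi>}"

definition W_prod :: "'a::field fps \<Rightarrow> ('a poly \<Rightarrow> 'a) \<Rightarrow> ('a poly \<Rightarrow> 'a) \<Rightarrow> 'a poly \<Rightarrow> 'a" where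
  "W_prod W \<phi> \<psi> = (THE \<chi>. \<chi> \<in> functionals \<and>
     (\<forall>n. \<chi> (monom (fps_nth W n) n) =
       (\<Sum>k\<le>n. \<phi> (monom (fps_nth W k) k) * \<psi> (monom (fps_nth W (n - k)) (n - k)))))"

primrec W_power :: "'a::field fps \<Rightarrow> ('a poly \<Rightarrow> 'a) \<Rightarrow> nat \<Rightarrow> 'a poly \<Rightarrow> 'a" where
  "W_power W \<eta> 0 = (\<lambda>p. poly p 0)"
| "W_power W \<eta> (Suc r) = W_prod W \<eta> (W_power W \<eta> r)"

definition val :: "('a::field poly \<Rightarrow> 'a) \<Rightarrow> enat" where
  "val \<phi> = (if \<phi> = (\<lambda>_. 0) then \<infinity> else enat (LEAST n. \<phi> (monom 1 n) \<noteq> 0))"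

definition W_dual_basis :: "'a::field fps \<Rightarrow> (nat \<Rightarrow> 'a poly) \<Rightarrow> nat \<Rightarrow> 'a poly \<Rightarrow> 'a" where
  "W_dual_basis W p r = (THE \<phi>. \<phi> \<in> functionals \<and>
     (\<forall>n. \<phi> (smult (fps_nth W n) (p n)) = (if n = r then 1 else 0)))"

definition W_translation :: "'a::field fps \<Rightarrow> 'a \<Rightarrow> 'a poly \<Rightarrow> 'a poly" where
  "W_translation W h = (THE T. Vector_Spaces.linear smult smult T \<and>
     (\<forall>n. T (monom (fps_nth W n) n) =
       (\<Sum>k\<le>n. smult (h ^ (n - k) * fps_nth W (n - k)) (monom (fps_nth W k) k))))"

definition Q_op :: "'a::field fps \<Rightarrow> (nat \<Rightarrow> 'a poly) \<Rightarrow> 'a poly \<Rightarrow> 'a poly" where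
  "Q_op W p = (THE Q. Vector_Spaces.linear smult smult Q \<and> Q (p 0) = 0 \<and>
     (\<forall>n\<ge>1. Q (smult (fps_nth W n) (p n)) = smult (fps_nth W (n - 1)) (p (n - 1))))"

definition W_Sheffer :: "'a::field fps \<Rightarrow> (nat \<Rightarrow> 'a poly) \<Rightarrow> bool" where
  "W_Sheffer W p \<longleftrightarrow> graded p \<and>
     (\<forall>h. Q_op W p \<circ> W_translation W h = W_translation W h \<circ> Q_op W p)"


subsection \<open>Existence and uniqueness of the described maps\<close>

lemma vector_space_smult: "vector_space (smult :: 'a::field \<Rightarrow> 'a poly \<Rightarrow> 'a poly)"
  by unfold_locales (auto simp: smult_add_right smult_add_left)

lemma vector_space_mult: "vector_space ((*) :: 'a::field \<Rightarrow> 'a \<Rightarrow> 'a)"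
  by unfold_locales (auto simp: algebra_simps)

lemma linear_ex1:
  fixes p :: "nat \<Rightarrow> 'a::field poly" and s :: "'a \<Rightarrow> 'b::ab_group_add \<Rightarrow> 'b"
  assumes "graded p" and "vector_space s"
  shows "\<exists>!f. Vector_Spaces.linear smult s f \<and> (\<forall>n. f (p n) = g n)"
proof -
  interpret V: vector_space "smult :: 'a \<Rightarrow> 'a poly \<Rightarrow> 'a poly" by (rule vector_space_smult)
  interpret S: vector_space s by fact
  interpret P: vector_space_pair "smult :: 'a \<Rightarrow> 'a poly \<Rightarrow> 'a poly" s ..
  have nz: "p n \<noteq> 0" and dg: "degree (p n) = n" for n
    using assms(1) by (auto simp: graded_def)
  have inj: "inj p" by (metis injI dg)
  have low: "q = 0 \<or> degree q < n" if "q \<in> V.span (p ` {..<n})" for q n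
    using that
  proof (induction rule: V.span_induct_alt)
    case base then show ?case by simp
  next
    case (step c x y)
    then have "degree (smult c x) < n"
      using dg by (auto intro: le_less_trans[OF degree_smult_le])
    with step.IH show ?case by (auto intro: degree_add_less)
  qed
  have fin: "V.independent (p ` {..<n})" for n
  proof (induction n)
    case 0 then show ?case by (simp add: V.independent_empty)
  next
    case (Suc n)
    have "p n \<notin> V.span (p ` {..<n})" using low[of "p n" n] nz[of n] dg[of n] by linarith
    then show ?case using Suc unfolding lessThan_Suc image_insert by (rule V.independent_insertI)
  qed
  have ind: "V.independent (range p)"
  proof
    assume "V.dependent (range p)"
    then obtain B u where B: "finite B" "B \<subseteq> range p"
      and u: "\<exists>v\<in>B. u v \<noteq> 0" "(\<Sum>v\<in>B. smult (u v) v) = 0"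
      unfolding V.dependent_explicit by (elim exE conjE) (rule that)
    have "V.dependent B"
      unfolding V.dependent_explicit using B(1) u by (intro exI[of _ B] exI[of _ u] conjI subset_refl)
    obtain N where N: "finite N" "B = p ` N" using finite_subset_image[OF B] by (elim exE conjE)
    obtain n where "N \<subseteq> {..<n}" using finite_nat_bounded[OF N(1)] by (elim exE)
    then have "B \<subseteq> p ` {..<n}" using N(2) by (simp only: image_mono)
    from V.independent_mono[OF fin this] \<open>V.dependent B\<close> show False by (rule notE)
  qed
  have span: "q \<in> V.span (range p)" for q
  proof (induction "degree q" arbitrary: q rule: less_induct)
    case less
    define n c where "n = degree q" and "c = coeff q n / coeff (p n) n"
    have cn: "coeff (q - smult c (p n)) n = 0"
    proof -
      have "coeff (p n) n \<noteq> 0" using leading_coeff_neq_0[OF nz[of n]] unfolding dg[of n] .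
      then show ?thesis by (simp add: c_def)
    qed
    have le: "degree (q - smult c (p n)) \<le> n"
      using degree_diff_le[OF eq_refl[OF n_def[symmetric]]
          order.trans[OF degree_smult_le eq_refl[OF dg]]] .
    have "q - smult c (p n) \<in> V.span (range p)"
    proof (cases "q - smult c (p n) = 0")
      case True then show ?thesis by (simp only: V.span_zero)
    next
      case False
      then have "degree (q - smult c (p n)) < n"
        using cn le using leading_coeff_neq_0[OF False]
        by (metis le_neq_implies_less)
      then show ?thesis using less[of "q - smult c (p n)"] by (simp only: n_def)
    qed
    moreover have "smult c (p n) \<in> V.span (range p)"
      by (intro V.span_scale V.span_base) auto
    ultimately have "(q - smult c (p n)) + smult c (p n) \<in> V.span (range p)"
      by (rule V.span_add)
    then show ?case by simp
  qed
  show ?thesis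
  proof (rule ex_ex1I)
    obtain f where "Vector_Spaces.linear smult s f" "\<forall>x\<in>range p. f x = g (inv p x)"
      using P.linear_independent_extend[OF ind, of "\<lambda>x. g (inv p x)"] by blast
    then show "\<exists>f. Vector_Spaces.linear smult s f \<and> (\<forall>n. f (p n) = g n)"
      using inj by auto
  next
    fix f f'
    assume f: "Vector_Spaces.linear smult s f \<and> (\<forall>n. f (p n) = g n)"
      and f': "Vector_Spaces.linear smult s f' \<and> (\<forall>n. f' (p n) = g n)"
    show "f = f'"
    proof
      fix x
      have eq: "f b = f' b" if "b \<in> range p" for b
        using that f f' by (elim rangeE) simp
      show "f x = f' x"
        by (rule P.linear_eq_on[OF conjunct1[OF f] conjunct1[OF f'] span eq])
    qed
  qed
qed

lemma graded_smult:
  assumes "\<And>n. fps_nth W n \<noteq> 0" "graded p"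
  shows "graded (\<lambda>n. smult (fps_nth W n) (p n))"
  using assms by (auto simp: graded_def)

lemma graded_monom:
  assumes "\<And>n. fps_nth W n \<noteq> 0"
  shows "graded (\<lambda>n. monom (fps_nth W n) n)"
  using assms by (auto simp: graded_def degree_monom_eq)

context
  fixes W :: "'a::field fps"
  assumes nz: "\<And>n. fps_nth W n \<noteq> 0"
begin

lemma W_prod:
  shows "W_prod W \<phi> \<psi> \<in> functionals"
    and "W_prod W \<phi> \<psi> (monom (fps_nth W n) n) =
      (\<Sum>k\<le>n. \<phi> (monom (fps_nth W k) k) * \<psi> (monom (fps_nth W (n - k)) (n - k)))"
  using theI'[OF linear_ex1[OF graded_monom[OF nz] vector_space_mult,
      of "\<lambda>n. \<Sum>k\<le>n. \<phi> (monom (fps_nth W k) k) * \<psi> (monom (fps_nth W (n - k)) (n - k))"]]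
  unfolding W_prod_def functionals_def mem_Collect_eq by blast+

lemma W_translation:
  shows "Vector_Spaces.linear smult smult (W_translation W h)"
    and "W_translation W h (monom (fps_nth W n) n) =
      (\<Sum>k\<le>n. smult (h ^ (n - k) * fps_nth W (n - k)) (monom (fps_nth W k) k))"
  using theI'[OF linear_ex1[OF graded_monom[OF nz] vector_space_smult,
      of "\<lambda>n. \<Sum>k\<le>n. smult (h ^ (n - k) * fps_nth W (n - k)) (monom (fps_nth W k) k)"]]
  unfolding W_translation_def by blast+

lemma W_dual_basis:
  assumes "graded p"
  shows "W_dual_basis W p r \<in> functionals"
    and "W_dual_basis W p r (smult (fps_nth W n) (p n)) = (if n = r then 1 else 0)"
  using theI'[OF linear_ex1[OF graded_smult[OF nz assms] vector_space_mult,
      of "\<lambda>n. if n = r then 1 else 0"]]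
  unfolding W_dual_basis_def functionals_def mem_Collect_eq by blast+

lemma Q_op:
  assumes "graded p"
  shows "Vector_Spaces.linear smult smult (Q_op W p)"
    and "Q_op W p (p 0) = 0"
    and "n \<ge> 1 \<Longrightarrow> Q_op W p (smult (fps_nth W n) (p n)) = smult (fps_nth W (n - 1)) (p (n - 1))"
proof -
  let ?g = "\<lambda>n. if n = 0 then 0 else smult (fps_nth W (n - 1)) (p (n - 1))"
  have zero: "Q (smult (fps_nth W 0) (p 0)) = 0 \<longleftrightarrow> Q (p 0) = 0"
    if "Vector_Spaces.linear smult smult Q" for Q :: "'a poly \<Rightarrow> 'a poly"
    using nz[of 0] module_hom.scale[OF Vector_Spaces.module_hom_linearI[OF that]] by simp
  have iff: "(Vector_Spaces.linear smult smult Q \<and> (\<forall>n. Q (smult (fps_nth W n) (p n)) = ?g n)) \<longleftrightarrow>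
     (Vector_Spaces.linear smult smult Q \<and> Q (p 0) = 0 \<and>
     (\<forall>n\<ge>1. Q (smult (fps_nth W n) (p n)) = smult (fps_nth W (n - 1)) (p (n - 1))))" for Q
  proof (intro conj_cong refl)
    assume "Vector_Spaces.linear smult smult Q"
    moreover have "(\<forall>n. R n = ?g n) \<longleftrightarrow> R 0 = 0 \<and> (\<forall>n\<ge>1. R n = smult (fps_nth W (n - 1)) (p (n - 1)))"
      for R :: "nat \<Rightarrow> 'a poly"
      using not_less_eq_eq by (intro iffI allI conjI impI) (simp_all split: if_splits)
    ultimately show "(\<forall>n. Q (smult (fps_nth W n) (p n)) = ?g n) \<longleftrightarrow> Q (p 0) = 0 \<and>
       (\<forall>n\<ge>1. Q (smult (fps_nth W n) (p n)) = smult (fps_nth W (n - 1)) (p (n - 1)))"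
      by (simp only: zero)
  qed
  have *: "Vector_Spaces.linear smult smult (Q_op W p) \<and> Q_op W p (p 0) = 0 \<and>
     (\<forall>n\<ge>1. Q_op W p (smult (fps_nth W n) (p n)) = smult (fps_nth W (n - 1)) (p (n - 1)))"
    using theI'[OF linear_ex1[OF graded_smult[OF nz assms] vector_space_smult, of ?g]]
    unfolding iff Q_op_def .
  show "Vector_Spaces.linear smult smult (Q_op W p)" "Q_op W p (p 0) = 0"
    "n \<ge> 1 \<Longrightarrow> Q_op W p (smult (fps_nth W n) (p n)) = smult (fps_nth W (n - 1)) (p (n - 1))"
    using * by blast+
qed

end

end

theory Submission
  imports Defs
begin

text \<open>
  Send a functional \<open>\<phi>\<close> to the power series whose coefficients are the numbers \<open>\<phi> (x^n / w\<^sub>n)\<close>.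
  This is a bijection from functionals to power series that turns the \<open>W\<close>-product into the
  ordinary product (\<open>series_of_W_prod\<close>, \<open>series_of_inject\<close>, \<open>series_of_surj\<close>).  A power series
  \<open>f\<close> also acts on polynomials, as \<open>f(D)\<close> where \<open>D\<close> lowers \<open>x^n / w\<^sub>n\<close> to
  \<open>x^(n-1) / w\<^sub>n\<^sub>-\<^sub>1\<close>, and this action is adjoint to multiplication: the series of
  \<open>\<phi> \<circ> f(D)\<close> is the series of \<open>\<phi>\<close> times \<open>f\<close> (\<open>series_of_comp_series_op\<close>).  As functionals
  separate polynomials, every identity between operators \<open>f(D)\<close> becomes an identity of series.

  The operator \<open>Q\<close> of a graded sequence is the adjoint of the shift on the dual basis:
  \<open>\<phi>\<^sub>r \<circ> Q = \<phi>\<^sub>r\<^sub>+\<^sub>1\<close> (\<open>W_dual_basis_comp_Q_op\<close>).  Hence \<open>Q = f(D)\<close> for a series \<open>f\<close> exactly when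
  the series of the dual basis are \<open>a, a f, a f^2, \<dots>\<close>, and it remains to see that the
  Sheffer condition says that \<open>Q\<close> has the form \<open>f(D)\<close>.  The translation by \<open>h\<close> is \<open>W(h D)\<close>, so
  operators \<open>f(D)\<close> commute with it.  For the converse the single value \<open>h = 1\<close> suffices,
  and therefore finite fields need no separate treatment.  The series \<open>W - 1\<close> starts
  in degree one and so has a compositional inverse.  Every series is thus a series in \<open>W - 1\<close>, and
  an operator that commutes with \<open>W(D)\<close> commutes with every \<open>g(D)\<close>
  (\<open>commute_with_all_series_op\<close>).  Such an operator is itself some \<open>f(D)\<close>: it is
  determined by its composite with evaluation at zero, because every functional is evaluation
  at zero after some \<open>g(D)\<close> (\<open>commuting_eq_series_op\<close>).

  The two valuations come from degrees: \<open>\<phi>\<^sub>0\<close> is nonzero on the constant \<open>p\<^sub>0\<close>, and \<open>Q = f(D)\<close> lowers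
  degrees by exactly one, so that \<open>f\<close> has order one.
\<close>

section \<open>Linear maps on polynomials\<close>

lemma linear_polyI:
  fixes f :: "'a::field poly \<Rightarrow> 'b::ab_group_add"
  assumes "vector_space s" "\<And>x y. f (x + y) = f x + f y" "\<And>c x. f (smult c x) = s c (f x)"
  shows "Vector_Spaces.linear smult s f"
  using assms vector_space_smult by (simp add: Vector_Spaces.linear_iff)

lemma linear_scale: "Vector_Spaces.linear s1 s2 f \<Longrightarrow> f (s1 c x) = s2 c (f x)"
  by (simp add: Vector_Spaces.linear_iff)

lemma linear_sum: "Vector_Spaces.linear s1 s2 f \<Longrightarrow> f (sum g A) = (\<Sum>i\<in>A. f (g i))"
  by (rule module_hom.sum[OF Vector_Spaces.module_hom_linearI])

lemma linear_eq_graded: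
  fixes p :: "nat \<Rightarrow> 'a::field poly" and s :: "'a \<Rightarrow> 'b::ab_group_add \<Rightarrow> 'b"
  assumes "graded p" "Vector_Spaces.linear smult s f" "Vector_Spaces.linear smult s g"
    "\<And>n. f (p n) = g (p n)"
  shows "f = g"
proof -
  have "vector_space s" using assms(2) by (simp add: Vector_Spaces.linear_iff)
  from linear_ex1[OF assms(1) this, of "\<lambda>n. g (p n)"] assms(2-) show ?thesis by blast
qed

lemma linear_id_poly: "Vector_Spaces.linear smult smult (id :: 'a::field poly \<Rightarrow> 'a poly)"
  by (rule linear_polyI[OF vector_space_smult]) auto

lemma linear_smult: "Vector_Spaces.linear smult smult (smult (a :: 'a::field))"
  by (rule linear_polyI[OF vector_space_smult]) (simp_all add: smult_add_right mult.commute)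

lemma coeff_functional: "(\<lambda>q. coeff q n) \<in> functionals"
  unfolding functionals_def by (auto intro: linear_polyI vector_space_mult)

lemma eval_functional: "(\<lambda>q. poly q a) \<in> functionals"
  unfolding functionals_def by (auto intro: linear_polyI vector_space_mult)

lemma functional_comp:
  assumes "\<phi> \<in> functionals" "Vector_Spaces.linear smult smult A"
  shows "\<phi> \<circ> A \<in> functionals"
  using assms unfolding functionals_def by (auto intro: Vector_Spaces.linear_compose)

lemma functional_monom:
  assumes "\<phi> \<in> functionals"
  shows "\<phi> (monom c n) = c * \<phi> (monom 1 n)"
  using assms linear_scale[of smult "(*)" \<phi> c "monom 1 n"] by (simp add: functionals_def smult_monom)

lemma functional_zero: "\<phi> \<in> functionals \<Longrightarrow> \<phi> 0 = 0"
  using functional_monom[of \<phi> 0 0] by simp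

section \<open>Functionals as power series\<close>

definition series_of :: "'a::field fps \<Rightarrow> ('a poly \<Rightarrow> 'a) \<Rightarrow> 'a fps" where
  "series_of W \<phi> = Abs_fps (\<lambda>n. \<phi> (monom (fps_nth W n) n))"

text \<open>
  The operator \<open>f(D)\<close>, where \<open>D\<close> is the linear map taking \<open>x^n / w\<^sub>n\<close> to \<open>x^(n-1) / w\<^sub>n\<^sub>-\<^sub>1\<close> and
  constants to \<open>0\<close>.
\<close>
definition series_op :: "'a::field fps \<Rightarrow> 'a fps \<Rightarrow> 'a poly \<Rightarrow> 'a poly" where
  "series_op W f = (THE A. Vector_Spaces.linear smult smult A \<and>
     (\<forall>n. A (monom (fps_nth W n) n) =
       (\<Sum>k\<le>n. smult (fps_nth f (n - k)) (monom (fps_nth W k) k))))"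

lemma W_translation_eq_series_op:
  "W_translation W h = series_op W (Abs_fps (\<lambda>k. h ^ k * fps_nth W k))"
  by (simp add: W_translation_def series_op_def)

context
  fixes W :: "'a::field fps"
  assumes nz: "\<And>n. fps_nth W n \<noteq> 0"
begin

lemma series_of_inject:
  assumes "\<phi> \<in> functionals" "\<psi> \<in> functionals" "series_of W \<phi> = series_of W \<psi>"
  shows "\<phi> = \<psi>"
proof (rule linear_eq_graded[OF graded_monom[OF nz]])
  show "\<phi> (monom (fps_nth W n) n) = \<psi> (monom (fps_nth W n) n)" for n
    using arg_cong[OF assms(3), of "\<lambda>f. fps_nth f n"] by (simp add: series_of_def)
qed (use assms in \<open>auto simp: functionals_def\<close>)

lemma series_of_surj: "\<exists>\<phi>\<in>functionals. series_of W \<phi> = f"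
  using linear_ex1[OF graded_monom[OF nz] vector_space_mult, of "fps_nth f"]
  by (auto simp: functionals_def series_of_def fps_eq_iff)

lemma series_of_W_prod: "series_of W (W_prod W \<phi> \<psi>) = series_of W \<phi> * series_of W \<psi>"
  by (simp add: fps_eq_iff series_of_def fps_mult_nth W_prod(2)[OF nz] atLeast0AtMost)

lemma series_of_eval_0:
  assumes "fps_nth W 0 = 1"
  shows "series_of W (\<lambda>q. poly q 0) = 1"
  using assms by (auto simp: fps_eq_iff series_of_def poly_monom power_0_left)

lemma series_of_W_power:
  assumes "fps_nth W 0 = 1"
  shows "series_of W (W_power W \<eta> r) = series_of W \<eta> ^ r"
  by (induction r) (simp_all add: series_of_W_prod series_of_eval_0[OF assms])

lemma val_eq_order_series_of:
  assumes "\<phi> \<in> functionals" "fps_nth (series_of W \<phi>) n \<noteq> 0"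
    "\<And>m. m < n \<Longrightarrow> fps_nth (series_of W \<phi>) m = 0"
  shows "val \<phi> = enat n"
proof -
  have iff: "\<phi> (monom 1 m) = 0 \<longleftrightarrow> fps_nth (series_of W \<phi>) m = 0" for m
    using functional_monom[OF assms(1), of "fps_nth W m" m] nz by (simp add: series_of_def)
  then have "\<phi> \<noteq> (\<lambda>_. 0)" using assms(2) by fastforce
  moreover have "(LEAST m. \<phi> (monom 1 m) \<noteq> 0) = n"
    by (rule Least_equality) (use assms(2,3) iff not_less in blast)+
  ultimately show ?thesis by (simp add: val_def)
qed

section \<open>The action of power series on polynomials\<close>

lemma series_op:
  shows linear_series_op: "Vector_Spaces.linear smult smult (series_op W f)"
    and series_op_monom: "series_op W f (monom (fps_nth W n) n) =
      (\<Sum>k\<le>n. smult (fps_nth f (n - k)) (monom (fps_nth W k) k))"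
  using theI'[OF linear_ex1[OF graded_monom[OF nz] vector_space_smult,
      of "\<lambda>n. \<Sum>k\<le>n. smult (fps_nth f (n - k)) (monom (fps_nth W k) k)"]]
  unfolding series_op_def by blast+

lemma series_of_comp_series_op:
  assumes "\<phi> \<in> functionals"
  shows "series_of W (\<phi> \<circ> series_op W f) = series_of W \<phi> * f"
proof -
  have "\<phi> (sum g A) = (\<Sum>i\<in>A. \<phi> (g i))" "\<phi> (smult c q) = c * \<phi> q" for g c q and A :: "nat set"
    using assms by (auto simp: functionals_def linear_sum linear_scale)
  then show ?thesis
    by (simp add: fps_eq_iff series_of_def series_op_monom fps_mult_nth atLeast0AtMost)
      (simp add: mult.commute)
qed

lemma operator_eqI:
  assumes "Vector_Spaces.linear smult smult A" "Vector_Spaces.linear smult smult B"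
    and "\<And>\<phi>. \<phi> \<in> functionals \<Longrightarrow> series_of W (\<phi> \<circ> A) = series_of W (\<phi> \<circ> B)"
  shows "A = B"
proof
  fix q
  have "\<phi> \<circ> A = \<phi> \<circ> B" if "\<phi> \<in> functionals" for \<phi>
    using that assms by (intro series_of_inject functional_comp) auto
  from fun_cong[OF this[OF coeff_functional]] show "A q = B q" by (auto simp: poly_eq_iff)
qed

lemma series_op_1: "series_op W 1 = id"
  by (rule operator_eqI[OF linear_series_op linear_id_poly]) (simp add: series_of_comp_series_op)

lemma series_op_mult: "series_op W (f * g) = series_op W f \<circ> series_op W g"
  by (rule operator_eqI)
    (auto intro!: linear_series_op Vector_Spaces.linear_compose
      simp: series_of_comp_series_op functional_comp[OF _ linear_series_op] mult.assoc
        comp_assoc[symmetric])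

lemma series_op_expand:
  assumes "degree q \<le> N"
  shows "series_op W f q = (\<Sum>n\<le>N. smult (coeff q n / fps_nth W n)
    (\<Sum>k\<le>n. smult (fps_nth f (n - k)) (monom (fps_nth W k) k)))"
proof -
  have "q = (\<Sum>n\<le>N. smult (coeff q n / fps_nth W n) (monom (fps_nth W n) n))"
    using poly_as_sum_of_monoms'[OF assms] nz by (simp add: smult_monom)
  then have "series_op W f q
    = series_op W f (\<Sum>n\<le>N. smult (coeff q n / fps_nth W n) (monom (fps_nth W n) n))" by simp
  then show ?thesis
    by (simp only: linear_sum[OF linear_series_op] linear_scale[OF linear_series_op] series_op_monom)
qed

lemma series_op_cong_degree:
  assumes "degree q \<le> N" "\<And>n. n \<le> N \<Longrightarrow> fps_nth f n = fps_nth g n"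
  shows "series_op W f q = series_op W g q"
  unfolding series_op_expand[OF assms(1)] by (intro sum.cong arg_cong2[of _ _ _ _ smult] refl)
    (auto simp: assms(2))

lemma series_op_add: "series_op W (f + g) q = series_op W f q + series_op W g q"
  by (simp add: series_op_expand[OF order_refl] smult_add_left smult_add_right sum.distrib)

lemma series_op_lincomb:
  "series_op W (\<Sum>i\<in>I. fps_const (c i) * f i) q = (\<Sum>i\<in>I. smult (c i) (series_op W (f i) q))"
proof -
  have scale: "series_op W (fps_const a * g) q = smult a (series_op W g q)" for a g
    by (simp add: series_op_expand[OF order_refl] linear_sum[OF linear_smult] mult.left_commute)
  have zero: "series_op W 0 q = 0"
    by (simp add: series_op_expand[OF order_refl])
  show ?thesis
    by (induction I rule: infinite_finite_induct) (simp_all add: zero series_op_add scale)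
qed

text \<open>
  Up to any given degree a composition \<open>c \<circ> u\<close> agrees with a polynomial in \<open>u\<close>, since \<open>u\<close> has no
  constant term and so \<open>u^i\<close> starts in degree at least \<open>i\<close>.
\<close>
lemma series_op_compose:
  assumes "fps_nth u 0 = 0" "degree q \<le> N"
  shows "series_op W (c oo u) q = (\<Sum>i\<le>N. smult (fps_nth c i) (series_op W (u ^ i) q))"
proof -
  have "series_op W (c oo u) q = series_op W (\<Sum>i\<le>N. fps_const (fps_nth c i) * u ^ i) q"
  proof (rule series_op_cong_degree[OF assms(2)])
    fix n assume "n \<le> N"
    have "fps_nth (c oo u) n = (\<Sum>i\<le>n. fps_nth c i * fps_nth (u ^ i) n)"
      by (simp add: fps_compose_nth atLeast0AtMost)
    also have "\<dots> = (\<Sum>i\<le>N. fps_nth c i * fps_nth (u ^ i) n)"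
      using \<open>n \<le> N\<close> assms(1) by (intro sum.mono_neutral_left) (auto simp: startsby_zero_power_prefix)
    finally show "fps_nth (c oo u) n = fps_nth (\<Sum>i\<le>N. fps_const (fps_nth c i) * u ^ i) n"
      by (simp add: fps_sum_nth)
  qed
  then show ?thesis by (simp add: series_op_lincomb)
qed

section \<open>Operators commuting with translation\<close>

text \<open>
  Since \<open>u\<close> has a compositional inverse, every series is a series in \<open>u\<close>.  On a given polynomial the
  operator \<open>g(D)\<close> is thus a polynomial in \<open>u(D)\<close>.
\<close>
lemma commute_with_all_series_op:
  assumes A: "Vector_Spaces.linear smult smult A"
    and u: "fps_nth u 0 = 0" "fps_nth u 1 \<noteq> 0"
    and comm: "A \<circ> series_op W u = series_op W u \<circ> A"
  shows "A \<circ> series_op W g = series_op W g \<circ> A"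
proof
  fix q
  have "(g oo fps_inv u) oo u = g oo (fps_inv u oo u)"
    using u by (intro fps_compose_assoc[symmetric]) (simp_all add: fps_inv_def)
  also have "fps_inv u oo u = fps_X" using u by (rule fps_inv)
  finally obtain c where g: "g = c oo u" by (metis fps_compose_fps_X)
  have power: "A (series_op W (u ^ i) x) = series_op W (u ^ i) (A x)" for i x
    using fun_cong[OF comm] by (induction i arbitrary: x) (simp_all add: series_op_1 series_op_mult)
  \<comment> \<open>One truncation order must serve both \<open>q\<close> and \<open>A q\<close>.\<close>
  define N where "N = max (degree q) (degree (A q))"
  have N: "degree q \<le> N" "degree (A q) \<le> N" by (simp_all add: N_def)
  show "(A \<circ> series_op W g) q = (series_op W g \<circ> A) q"
    by (simp add: g series_op_compose[OF u(1) N(1)] series_op_compose[OF u(1) N(2)]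
        linear_sum[OF A] linear_scale[OF A] power)
qed

text \<open>
  With \<open>\<epsilon>\<close> the evaluation at zero, a functional with series \<open>g\<close> equals \<open>\<epsilon> \<circ> g(D)\<close>.  Its composite
  with \<open>A\<close> is \<open>\<epsilon> \<circ> A \<circ> g(D)\<close>, so the series \<open>f\<close> of \<open>\<epsilon> \<circ> A\<close> determines \<open>A\<close> as \<open>f(D)\<close>.
\<close>
lemma commuting_eq_series_op:
  assumes W0: "fps_nth W 0 = 1"
    and A: "Vector_Spaces.linear smult smult A"
    and comm: "A \<circ> series_op W W = series_op W W \<circ> A"
  shows "\<exists>f. A = series_op W f"
proof -
  define \<epsilon> where "\<epsilon> = (\<lambda>q :: 'a poly. poly q 0)"
  have \<epsilon>: "\<epsilon> \<in> functionals" "series_of W \<epsilon> = 1"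
    using eval_functional series_of_eval_0[OF W0] by (auto simp: \<epsilon>_def)
  have W1: "series_op W (W - 1) q = series_op W W q - q" for q
    using series_op_add[of "W - 1" 1 q] by (simp add: series_op_1)
  have comm_all: "A \<circ> series_op W g = series_op W g \<circ> A" for g
  proof (rule commute_with_all_series_op[OF A])
    show "A \<circ> series_op W (W - 1) = series_op W (W - 1) \<circ> A"
      using fun_cong[OF comm]
      by (auto simp: W1 module_hom.diff[OF Vector_Spaces.module_hom_linearI[OF A]])
  qed (use nz W0 in auto)
  have "A = series_op W (series_of W (\<epsilon> \<circ> A))"
  proof (rule operator_eqI[OF A linear_series_op])
    fix \<psi> :: "'a poly \<Rightarrow> 'a" assume \<psi>: "\<psi> \<in> functionals"
    let ?g = "series_of W \<psi>"
    have "\<psi> = \<epsilon> \<circ> series_op W ?g"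
      using \<psi> \<epsilon> by (intro series_of_inject)
        (auto intro: functional_comp linear_series_op simp: series_of_comp_series_op)
    then have "\<psi> \<circ> A = (\<epsilon> \<circ> A) \<circ> series_op W ?g"
      using comm_all[of ?g] by (metis comp_assoc)
    then show "series_of W (\<psi> \<circ> A) = series_of W (\<psi> \<circ> series_op W (series_of W (\<epsilon> \<circ> A)))"
      using \<psi> functional_comp[OF \<epsilon>(1) A] by (simp add: series_of_comp_series_op mult.commute)
  qed
  then show ?thesis ..
qed

lemma W_Sheffer_iff_series_op:
  assumes "fps_nth W 0 = 1" "graded p"
  shows "W_Sheffer W p \<longleftrightarrow> (\<exists>f. Q_op W p = series_op W f)"
proof
  assume "W_Sheffer W p"
  then have "Q_op W p \<circ> W_translation W 1 = W_translation W 1 \<circ> Q_op W p"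
    by (simp add: W_Sheffer_def)
  then have "Q_op W p \<circ> series_op W W = series_op W W \<circ> Q_op W p"
    by (simp add: W_translation_eq_series_op fps_nth_inverse)
  from commuting_eq_series_op[OF assms(1) Q_op(1)[OF nz assms(2)] this]
  show "\<exists>f. Q_op W p = series_op W f" .
next
  assume "\<exists>f. Q_op W p = series_op W f"
  then obtain f where f: "Q_op W p = series_op W f" ..
  have "series_op W f \<circ> series_op W g = series_op W g \<circ> series_op W f" for g
    by (metis series_op_mult mult.commute)
  then show "W_Sheffer W p"
    using assms by (simp add: W_Sheffer_def W_translation_eq_series_op f)
qed

section \<open>The dual basis\<close>

text \<open>
  Let \<open>L\<close> take the graded basis to the monomials.  Then \<open>\<phi>\<^sub>r\<close> is the coefficient of \<open>x^r\<close> after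
  \<open>L\<close>, and \<open>L\<close> is injective because the map from monomials back to the basis inverts it.
\<close>
lemma W_dual_basis_separates:
  assumes "graded p" "\<And>r. W_dual_basis W p r q = W_dual_basis W p r q'"
  shows "q = q'"
proof -
  let ?p = "\<lambda>n. smult (fps_nth W n) (p n)"
  note gr = graded_smult[OF nz assms(1)]
  obtain L where L: "Vector_Spaces.linear smult smult L" "\<And>n. L (?p n) = monom 1 n"
    using linear_ex1[OF gr vector_space_smult, of "monom 1"] by blast
  have "graded (monom (1 :: 'a))" by (simp add: graded_def degree_monom_eq)
  from linear_ex1[OF this vector_space_smult, of ?p]
  obtain M where M: "Vector_Spaces.linear smult smult M" "\<And>n. M (monom 1 n) = ?p n" by blast
  have "M \<circ> L = id"
    by (rule linear_eq_graded[OF gr Vector_Spaces.linear_compose[OF L(1) M(1)] linear_id_poly])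
      (simp add: L(2) M(2))
  then have inverse: "M (L x) = x" for x by (metis comp_apply id_apply)
  have "W_dual_basis W p r = (\<lambda>x. coeff x r) \<circ> L" for r
    by (rule linear_eq_graded[OF gr, of "(*)"])
      (use W_dual_basis[OF nz assms(1)] functional_comp[OF coeff_functional L(1)]
        in \<open>auto simp: functionals_def L(2)\<close>)
  then have "L q = L q'" using assms(2) by (auto simp: poly_eq_iff)
  then show ?thesis using inverse by metis
qed

lemma W_dual_basis_comp_Q_op:
  assumes "graded p"
  shows "W_dual_basis W p r \<circ> Q_op W p = W_dual_basis W p (Suc r)"
proof (rule linear_eq_graded[OF graded_smult[OF nz assms], of "(*)"])
  note Q = Q_op[OF nz assms] and dual = W_dual_basis[OF nz assms]
  show "Vector_Spaces.linear smult (*) (W_dual_basis W p r \<circ> Q_op W p)"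
    "Vector_Spaces.linear smult (*) (W_dual_basis W p (Suc r))"
    using functional_comp[OF dual(1) Q(1)] dual(1) by (auto simp: functionals_def)
  show "(W_dual_basis W p r \<circ> Q_op W p) (smult (fps_nth W n) (p n)) =
      W_dual_basis W p (Suc r) (smult (fps_nth W n) (p n))" for n
  proof (cases n)
    case 0
    then show ?thesis
      using Q(2) dual(2)[of "Suc r" 0]
      by (simp add: linear_scale[OF Q(1)] functional_zero[OF dual(1)])
  next
    case (Suc m)
    then show ?thesis using Q(3)[of n] by (simp add: dual(2))
  qed
qed

lemma Q_op_eq_series_op_iff:
  assumes "graded p"
  shows "Q_op W p = series_op W f \<longleftrightarrow> (\<forall>r. series_of W (W_dual_basis W p r) =
    series_of W (W_dual_basis W p 0) * f ^ r)"
proof -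
  note dual = W_dual_basis(1)[OF nz assms]
  let ?\<phi> = "W_dual_basis W p"
  have "Q_op W p = series_op W f \<longleftrightarrow> (\<forall>r. ?\<phi> r \<circ> Q_op W p = ?\<phi> r \<circ> series_op W f)"
  proof
    assume eq: "\<forall>r. ?\<phi> r \<circ> Q_op W p = ?\<phi> r \<circ> series_op W f"
    show "Q_op W p = series_op W f"
    proof
      show "Q_op W p q = series_op W f q" for q
        by (rule W_dual_basis_separates[OF assms]) (use eq[rule_format, THEN fun_cong, of _ q] in simp)
    qed
  qed simp
  also have "\<dots> \<longleftrightarrow> (\<forall>r. series_of W (?\<phi> (Suc r)) = series_of W (?\<phi> r) * f)"
    unfolding W_dual_basis_comp_Q_op[OF assms] series_of_comp_series_op[OF dual, symmetric]
    using series_of_inject[OF dual functional_comp[OF dual linear_series_op]]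
    by (intro iff_allI) (rule iffI; simp)
  also have "\<dots> \<longleftrightarrow> (\<forall>r. series_of W (?\<phi> r) = series_of W (?\<phi> 0) * f ^ r)"
  proof (intro iffI allI)
    fix r
    assume rec: "\<forall>r. series_of W (?\<phi> (Suc r)) = series_of W (?\<phi> r) * f"
    show "series_of W (?\<phi> r) = series_of W (?\<phi> 0) * f ^ r"
      by (induction r) (simp_all add: rec[rule_format] mult.assoc power_commutes)
  next
    fix r
    assume closed: "\<forall>r. series_of W (?\<phi> r) = series_of W (?\<phi> 0) * f ^ r"
    show "series_of W (?\<phi> (Suc r)) = series_of W (?\<phi> r) * f"
      unfolding closed[rule_format, of "Suc r"] closed[rule_format, of r]
      by (simp add: mult.assoc power_commutes)
  qed
  finally show ?thesis .
qed

text \<open>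
  The polynomial \<open>p\<^sub>0\<close> is constant, so a functional that is nonzero on it is nonzero on \<open>1\<close>.
\<close>
lemma W_dual_basis_0_order:
  assumes "graded p"
  shows "fps_nth (series_of W (W_dual_basis W p 0)) 0 \<noteq> 0"
proof
  note dual = W_dual_basis[OF nz assms]
  assume "fps_nth (series_of W (W_dual_basis W p 0)) 0 = 0"
  then have "W_dual_basis W p 0 (monom 1 0) = 0"
    using functional_monom[OF dual(1), of 0 "fps_nth W 0" 0] nz by (simp add: series_of_def)
  moreover obtain c where "smult (fps_nth W 0) (p 0) = monom c 0"
    using assms degree0_coeffs[of "p 0"] by (auto simp: graded_def monom_0)
  ultimately show False
    using dual(2)[of 0 0] functional_monom[OF dual(1), of 0 c 0] by simp
qed

text \<open>
  The operator \<open>Q\<close> kills constants but not \<open>p\<^sub>1\<close>, and on polynomials of degree at most \<open>1\<close> only the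
  first two coefficients of \<open>f\<close> matter.
\<close>
lemma Q_op_series_order:
  assumes "graded p" "Q_op W p = series_op W f"
  shows "fps_nth f 0 = 0" "fps_nth f 1 \<noteq> 0"
proof -
  note Q = Q_op[OF nz assms(1), unfolded assms(2)]
  have gr: "p n \<noteq> 0" "degree (p n) = n" for n using assms(1) by (auto simp: graded_def)
  have "series_op W f (p 0) = series_op W (\<Sum>i\<in>{0::nat}. fps_const (fps_nth f 0) * 1) (p 0)"
    by (rule series_op_cong_degree[of _ 0]) (simp_all add: gr)
  then have "series_op W f (p 0) = smult (fps_nth f 0) (p 0)"
    by (simp only: series_op_lincomb) (simp add: series_op_1)
  then show f0: "fps_nth f 0 = 0" using Q(2) gr(1)[of 0] by simp
  show "fps_nth f 1 \<noteq> 0"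
  proof
    assume f1: "fps_nth f 1 = 0"
    have "fps_nth f n = 0" if "n \<le> 1" for n using that f0 f1 by (cases n) auto
    then have "series_op W f (p 1) = series_op W 0 (p 1)"
      by (intro series_op_cong_degree[of _ 1]) (simp_all add: gr)
    also have "\<dots> = 0" by (simp add: series_op_expand[OF order_refl])
    finally show False
      using Q(3)[of 1] gr(1)[of 0] nz[of 0] by (simp add: linear_scale[OF linear_series_op])
  qed
qed

end

section \<open>Sheffer sequences and their dual bases\<close>

theorem theorem3p7:
  fixes w :: "nat \<Rightarrow> 'a::field" and W :: "'a fps" and p :: "nat \<Rightarrow> 'a poly"
  assumes "W = Abs_fps (\<lambda>n. 1 / w n)"
    and "w 0 = 1"
    and "\<And>n. w n \<noteq> 0"
    and "graded p"
  shows "W_Sheffer W p \<longleftrightarrow>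
    (\<exists>\<xi>\<in>functionals. \<exists>\<eta>\<in>functionals. val \<xi> = 0 \<and> val \<eta> = 1 \<and>
      (\<forall>r. W_dual_basis W p r = W_prod W \<xi> (W_power W \<eta> r)))"
proof -
  have nz: "fps_nth W n \<noteq> 0" for n using assms by simp
  have W0: "fps_nth W 0 = 1" using assms by simp
  note dual = W_dual_basis(1)[OF nz \<open>graded p\<close>]
  have series: "W_dual_basis W p r = W_prod W \<xi> (W_power W \<eta> r) \<longleftrightarrow>
      series_of W (W_dual_basis W p r) = series_of W \<xi> * series_of W \<eta> ^ r" for r \<xi> \<eta>
    using series_of_inject[OF nz dual W_prod(1)[OF nz]]
    by (metis series_of_W_prod[OF nz] series_of_W_power[OF nz W0])
  show ?thesis
    unfolding W_Sheffer_iff_series_op[OF nz W0 \<open>graded p\<close>]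
  proof
    assume "\<exists>f. Q_op W p = series_op W f"
    then obtain f where f: "Q_op W p = series_op W f" ..
    obtain \<eta> where \<eta>: "\<eta> \<in> functionals" "series_of W \<eta> = f"
      using series_of_surj[OF nz] by blast
    have "val (W_dual_basis W p 0) = enat 0"
      by (rule val_eq_order_series_of[OF nz dual W_dual_basis_0_order[OF nz \<open>graded p\<close>]]) simp
    moreover have "val \<eta> = enat 1"
      using Q_op_series_order[OF nz \<open>graded p\<close> f] \<eta>(2)
      by (intro val_eq_order_series_of[OF nz \<eta>(1)]) auto
    moreover have "\<forall>r. W_dual_basis W p r = W_prod W (W_dual_basis W p 0) (W_power W \<eta> r)"
      unfolding series \<eta>(2) by (rule iffD1[OF Q_op_eq_series_op_iff[OF nz \<open>graded p\<close>] f])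
    ultimately show "\<exists>\<xi>\<in>functionals. \<exists>\<eta>\<in>functionals. val \<xi> = 0 \<and> val \<eta> = 1 \<and>
        (\<forall>r. W_dual_basis W p r = W_prod W \<xi> (W_power W \<eta> r))"
      unfolding zero_enat_def one_enat_def using dual \<eta>(1) by blast
  next
    assume "\<exists>\<xi>\<in>functionals. \<exists>\<eta>\<in>functionals. val \<xi> = 0 \<and> val \<eta> = 1 \<and>
        (\<forall>r. W_dual_basis W p r = W_prod W \<xi> (W_power W \<eta> r))"
    then obtain \<xi> \<eta> where
      "series_of W (W_dual_basis W p r) = series_of W \<xi> * series_of W \<eta> ^ r" for r
      unfolding series by blast
    from this this[of 0] have "\<forall>r. series_of W (W_dual_basis W p r) =
        series_of W (W_dual_basis W p 0) * series_of W \<eta> ^ r" by simp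
    then have "Q_op W p = series_op W (series_of W \<eta>)"
      by (rule iffD2[OF Q_op_eq_series_op_iff[OF nz \<open>graded p\<close>]])
    then show "\<exists>f. Q_op W p = series_op W f" ..
  qed
qed

end
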